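(* The order of the product of any pair of horizontal class transpositions belongs to the set $\{1,2,3,4,6,12\}$. Moreover, for every number $d$ in $\{1,2,3,4,6,12\}$ there is a pair of horizontal class transpositions whose product has order equal to $d$.
   Context: For integers $0\le r<m$ write $r(m)=r+m\mathbb{Z}=\{r+km : k\in\mathbb{Z}\}$. If $r_1(m_1)\cap r_2(m_2)=\emptyset$, the class transposition $\tau_{r_1(m_1),r_2(m_2)}$ is the permutation of $\mathbb{Z}$ that interchanges $r_1+km_1$ and $r_2+km_2$ for every $k\in\mathbb{Z}$ and fixes every other integer. It is called horizontal if $m_1=m_2$; thus a horizontal class transposition is $\tau_{r_1(n),r_2(n)}$ with $n$ a positive integer, $0\le r_1,r_2<n$ and $r_1\ne r_2$. The two members of a pair are allowed to coincide and need not have the same modulus. Products are taken in the group $\mathrm{Sym}(\mathbb{Z})$ of all permutations of $\mathbb{Z}$. *)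

theory Defs
  imports "HOL-Algebra.Bij" "HOL-Algebra.Multiplicative_Group"
begin

definition residue_class :: "int \<Rightarrow> int \<Rightarrow> int set" where
  "residue_class r m = {r + k * m | k. True}"

text \<open>On \<open>r\<^sub>1(m\<^sub>1)\<close> the quotient \<open>(x - r\<^sub>1) div m\<^sub>1\<close> is the \<open>k\<close> with \<open>x = r\<^sub>1 + k m\<^sub>1\<close>.
  The function is meaningful only for disjoint residue classes with positive moduli.\<close>

definition class_transposition :: "int \<Rightarrow> int \<Rightarrow> int \<Rightarrow> int \<Rightarrow> int \<Rightarrow> int" where
  "class_transposition r1 m1 r2 m2 x =
    (if x \<in> residue_class r1 m1 then r2 + ((x - r1) div m1) * m2
     else if x \<in> residue_class r2 m2 then r1 + ((x - r2) div m2) * m1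
     else x)"

definition horizontal_class_transpositions :: "(int \<Rightarrow> int) set" where
  "horizontal_class_transpositions =
    {class_transposition r1 n r2 n | r1 r2 n.
       0 < n \<and> 0 \<le> r1 \<and> r1 < n \<and> 0 \<le> r2 \<and> r2 < n \<and> r1 \<noteq> r2}"

text \<open>The product in \<open>BijGroup UNIV\<close> is composition, the right factor being applied first. In it,
  \<open>ord\<close> of an element of infinite order is \<open>0\<close>.\<close>

abbreviation Sym_int :: "(int \<Rightarrow> int) monoid" where
  "Sym_int \<equiv> BijGroup UNIV"

lemma class_transposition_eqs:
  assumes "0 < m1" "0 < m2" "residue_class r1 m1 \<inter> residue_class r2 m2 = {}"
  shows "class_transposition r1 m1 r2 m2 (r1 + k * m1) = r2 + k * m2"
    and "class_transposition r1 m1 r2 m2 (r2 + k * m2) = r1 + k * m1"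
    and "x \<notin> residue_class r1 m1 \<union> residue_class r2 m2 \<Longrightarrow>
           class_transposition r1 m1 r2 m2 x = x"
proof -
  have 1: "r1 + k * m1 \<in> residue_class r1 m1" and 2: "r2 + k * m2 \<in> residue_class r2 m2"
    by (auto simp: residue_class_def)
  then have 3: "r2 + k * m2 \<notin> residue_class r1 m1"
    using assms(3) by blast
  show "class_transposition r1 m1 r2 m2 (r1 + k * m1) = r2 + k * m2"
    using 1 assms(1) by (simp add: class_transposition_def)
  show "class_transposition r1 m1 r2 m2 (r2 + k * m2) = r1 + k * m1"
    using 2 3 assms(2) by (simp add: class_transposition_def)
  show "class_transposition r1 m1 r2 m2 x = x"
    if "x \<notin> residue_class r1 m1 \<union> residue_class r2 m2"
    using that by (simp add: class_transposition_def)
qed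

lemma class_transposition_in_Sym_int:
  assumes "0 < m1" "0 < m2" "residue_class r1 m1 \<inter> residue_class r2 m2 = {}"
  shows "class_transposition r1 m1 r2 m2 \<in> carrier Sym_int"
proof -
  let ?t = "class_transposition r1 m1 r2 m2"
  have "?t (?t x) = x" for x
  proof -
    consider k where "x = r1 + k * m1" | k where "x = r2 + k * m2"
      | "x \<notin> residue_class r1 m1 \<union> residue_class r2 m2"
      by (auto simp: residue_class_def)
    then show ?thesis
      by cases (simp_all add: class_transposition_eqs[OF assms])
  qed
  then have "bij ?t"
    by (intro o_bij[of ?t]) auto
  then show ?thesis
    by (simp add: BijGroup_def Bij_def)
qed

lemma residue_class_disjoint_iff:
  assumes "0 \<le> r1" "r1 < n" "0 \<le> r2" "r2 < n"
  shows "residue_class r1 n \<inter> residue_class r2 n = {} \<longleftrightarrow> r1 \<noteq> r2"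
proof
  assume "residue_class r1 n \<inter> residue_class r2 n = {}"
  moreover have "r1 \<in> residue_class r1 n"
    unfolding residue_class_def by (auto intro: exI[of _ 0])
  ultimately show "r1 \<noteq> r2" by blast
next
  assume ne: "r1 \<noteq> r2"
  have "r1 = r2" if "r1 + k * n = r2 + l * n" for k l
    using arg_cong[OF that, of "\<lambda>z. z mod n"] assms by simp
  with ne show "residue_class r1 n \<inter> residue_class r2 n = {}"
    unfolding residue_class_def by blast
qed

lemma horizontal_class_transpositions_in_Sym_int:
  "horizontal_class_transpositions \<subseteq> carrier Sym_int"
  unfolding horizontal_class_transpositions_def
  using class_transposition_in_Sym_int residue_class_disjoint_iff by blast

end

theory Submission
  imports Defs
begin

text \<open>
  A product of two involutions \<open>s\<close> and \<open>t\<close> is best seen through the graph on the integers whose edges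
  join each \<open>x\<close> to \<open>s x\<close> and to \<open>t x\<close>. Its components are alternating paths or cycles. On a path with
  \<open>k\<close> vertices \<open>s \<circ> t\<close> is a single \<open>k\<close>-cycle, so the order of \<open>s \<circ> t\<close> is governed by the lengths of the
  paths. The claim is that \<open>(s \<circ> t) ^^ 12\<close> is always the identity for horizontal class transpositions;
  since \<open>1, 2, 3, 4, 6, 12\<close> are exactly the divisors of \<open>12\<close>, this is the first half.

  Call an edge \<open>{x, s x}\<close> inner if \<open>t\<close> moves both of its ends. Without inner edges every component is a
  path with at most four vertices, and \<open>lcm(1, 2, 3, 4) = 12\<close>. It therefore suffices to look at the
  components of inner edges (\<open>involutions_pow_12\<close>).

  Now let \<open>s\<close> and \<open>t\<close> interchange \<open>a(n), b(n)\<close> and \<open>c(m), d(m)\<close>, with \<open>a < b\<close> and \<open>c < d\<close>. They move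
  points by \<open>\<delta> = b - a\<close> and by \<open>\<epsilon> = d - c\<close>. Passing to the inverse product if necessary, let
  \<open>n \<le> m\<close>. Then \<open>0 < \<delta> < m\<close> and \<open>0 < \<epsilon> < m\<close>, so an inner edge forces \<open>\<delta> = \<epsilon>\<close> or \<open>\<delta> + \<epsilon> = m\<close>. In
  the first case the edge is also an edge of \<open>t\<close>, and \<open>s \<circ> t\<close> fixes its ends. In the second case it is
  the middle of a path, and the position of the residues in \<open>[0, n)\<close> and \<open>[0, m)\<close> shows that the path
  has four vertices, or six if \<open>n\<close> divides \<open>\<epsilon>\<close> (\<open>ordered_product_pow_12\<close>).

  For the second half, a product of transpositions modulo \<open>n\<close> and \<open>m\<close> commutes with translation by a
  common multiple of \<open>n\<close> and \<open>m\<close>, so that the order in an example is read off from a finite window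
  (\<open>horizontal_product_order_witness\<close>).
\<close>

section \<open>Products of two involutions\<close>

lemma fixed_point_pow_12:
  assumes "(f ^^ k) x = x" "k dvd 12"
  shows "(f ^^ 12) x = x"
proof -
  obtain j where j: "12 = k * j" using assms(2) by (rule dvdE)
  have "((f ^^ k) ^^ j) x = x"
    by (induction j) (simp_all add: assms(1))
  then show ?thesis by (simp add: j funpow_mult)
qed

text \<open>As \<open>t \<circ> s\<close> is the inverse of \<open>s \<circ> t\<close>, the fixed points of \<open>(s \<circ> t) ^^ k\<close> and \<open>(t \<circ> s) ^^ k\<close> agree.
  Conjugation by \<open>s\<close> or \<open>t\<close> exchanges the two powers, so this set is a union of components.\<close>

lemma funpow_involutions_cancel:
  assumes "\<And>x. s (s x) = x" "\<And>x. t (t x) = x"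
  shows "((t \<circ> s) ^^ k) (((s \<circ> t) ^^ k) x) = x"
proof (induction k)
  case (Suc k)
  have unfold: "((t \<circ> s) ^^ Suc k) (((s \<circ> t) ^^ Suc k) x)
      = ((t \<circ> s) ^^ k) (t (s (s (t (((s \<circ> t) ^^ k) x)))))"
    unfolding funpow_Suc_right[of k "t \<circ> s"] by simp
  show ?case unfolding unfold using Suc by (simp only: assms)
qed simp

lemma funpow_involutions_swap:
  assumes "\<And>x. s (s x) = x" "\<And>x. t (t x) = x" "((s \<circ> t) ^^ k) x = x"
  shows "((t \<circ> s) ^^ k) x = x"
  using funpow_involutions_cancel[of s t k x] assms by simp

lemma funpow_involutions_left:
  assumes "\<And>x. s (s x) = x" "\<And>x. t (t x) = x" "((s \<circ> t) ^^ k) x = x"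
  shows "((s \<circ> t) ^^ k) (s x) = s x"
proof -
  have "((s \<circ> t) ^^ k) (s x) = s (((t \<circ> s) ^^ k) x)"
    by (induction k) simp_all
  with funpow_involutions_swap[OF assms] show ?thesis by simp
qed

lemma funpow_involutions_right:
  assumes "\<And>x. s (s x) = x" "\<And>x. t (t x) = x" "((s \<circ> t) ^^ k) x = x"
  shows "((s \<circ> t) ^^ k) (t x) = t x"
  using assms funpow_involutions_left[of t s k x] funpow_involutions_swap[of s t k x]
    funpow_involutions_swap[of t s k "t x"] by blast

text \<open>In a component without inner edges, an edge of \<open>s\<close> is at one end of its component, so the
  component consists of at most an edge of \<open>s\<close>, an edge of \<open>t\<close> and another edge of \<open>s\<close>. In the proof, \<open>G\<close>
  is a union of components that contains all inner edges. Starting from a fixed point of \<open>s\<close> or of \<open>t\<close>,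
  one walks along the component: it ends after at most three edges, or it meets \<open>G\<close>.\<close>

lemma involutions_pow_12:
  assumes s: "\<And>x. s (s x) = x" and t: "\<And>x. t (t x) = x"
    and inner: "\<And>x. s x \<noteq> x \<Longrightarrow> t x \<noteq> x \<Longrightarrow> t (s x) \<noteq> s x \<Longrightarrow> ((s \<circ> t) ^^ 12) x = x"
  shows "(s \<circ> t) ^^ 12 = id"
proof
  fix x
  define G where "G = {y. ((s \<circ> t) ^^ 12) y = y}"
  have Gs: "y \<in> G" if "s y \<in> G" for y
    using funpow_involutions_left[OF s t, of 12 "s y"] that by (simp add: G_def s)
  have Gt: "y \<in> G" if "t y \<in> G" for y
    using funpow_involutions_right[OF s t, of 12 "t y"] that by (simp add: G_def t)
  have G: "y \<in> G" if "((s \<circ> t) ^^ k) y = y" "k dvd 12" for y k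
    unfolding G_def using fixed_point_pow_12[OF that] by blast
  have edge: "y \<in> G \<or> s y = y \<or> t y = y \<or> t (s y) = s y" for y
    using inner[of y] by (auto simp: G_def)
  have end_s: "y \<in> G" if y: "s y = y" for y
    using edge[of "t y"]
  proof (elim disjE)
    assume "s (t y) = t y"
    then show ?thesis using y by (intro G[of 2]) (simp add: t numeral_eq_Suc, simp)
  next
    assume "t (t y) = t y"
    then show ?thesis using y by (intro G[of 1]) (simp_all add: t)
  next
    assume "t (s (t y)) = s (t y)"
    then show ?thesis using y by (intro G[of 3]) (simp add: s t numeral_eq_Suc, simp)
  qed (rule Gt)
  have end_t: "y \<in> G" if y: "t y = y" for y
    using edge[of "t (s y)"]
  proof (elim disjE)
    assume "t (s y) \<in> G"
    then show ?thesis by (rule Gs[OF Gt])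
  next
    assume "s (t (s y)) = t (s y)"
    then show ?thesis using y by (intro G[of 3]) (simp add: s t numeral_eq_Suc, simp)
  next
    assume "t (t (s y)) = t (s y)"
    then show ?thesis using y by (intro G[of 2]) (simp add: s t numeral_eq_Suc, simp)
  next
    assume "t (s (t (s y))) = s (t (s y))"
    then show ?thesis using y by (intro G[of 4]) (simp add: s t numeral_eq_Suc, simp)
  qed
  have "x \<in> G"
    using edge[of x] end_s[of x] end_t[of x] end_t[of "s x"] Gs[of x] by blast
  then show "((s \<circ> t) ^^ 12) x = id x" by (simp add: G_def)
qed

section \<open>Horizontal class transpositions\<close>

lemma horizontal_class_transposition_eq:
  "class_transposition a n b n x =
    (if n dvd x - a then x + (b - a) else if n dvd x - b then x - (b - a) else x)"
proof -
  have [simp]: "x \<in> residue_class r n \<longleftrightarrow> n dvd x - r" for r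
    unfolding residue_class_def dvd_def by (auto simp: algebra_simps)
  show ?thesis
    by (auto simp: class_transposition_def)
qed

lemma not_dvd_of_abs_less:
  fixes n z :: int
  assumes "z \<noteq> 0" "\<bar>z\<bar> < n"
  shows "\<not> n dvd z"
  using assms by (meson dvd_imp_le_int abs_le_D1 linorder_not_less abs_ge_self order.trans)

lemma horizontal_class_transposition_commute:
  assumes "0 \<le> a" "a < n" "0 \<le> b" "b < n" "a \<noteq> b"
  shows "class_transposition a n b n = class_transposition b n a n"
proof
  fix x
  have "\<not> n dvd (x - a) - (x - b)" using assms by (intro not_dvd_of_abs_less) auto
  then have "\<not> (n dvd x - a \<and> n dvd x - b)" using dvd_diff by blast
  then show "class_transposition a n b n x = class_transposition b n a n x"
    by (auto simp: horizontal_class_transposition_eq)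
qed

lemma horizontal_class_transposition_involution:
  assumes "0 \<le> a" "a < n" "0 \<le> b" "b < n" "a \<noteq> b"
  shows "class_transposition a n b n (class_transposition a n b n x) = x"
proof -
  have "\<not> n dvd (x - a) - (x - b)" using assms by (intro not_dvd_of_abs_less) auto
  then have 1: "\<not> (n dvd x - a \<and> n dvd x - b)" using dvd_diff by blast
  have 2: "\<not> (n dvd x - a \<and> n dvd x + (b - a) - a)"
  proof
    assume "n dvd x - a \<and> n dvd x + (b - a) - a"
    then have "n dvd (x + (b - a) - a) - (x - a)" using dvd_diff by blast
    moreover have "\<not> n dvd b - a" using assms by (intro not_dvd_of_abs_less) auto
    ultimately show False by simp
  qed
  show ?thesis
    using 1 2 by (auto simp: horizontal_class_transposition_eq)
qed

text \<open>The bounds on the residues cannot be replaced by congruences. They turn \<open>m dvd \<delta> - \<epsilon>\<close> and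
  \<open>m dvd \<delta> + \<epsilon>\<close> into \<open>\<delta> = \<epsilon>\<close> and \<open>\<delta> + \<epsilon> = m\<close>, and they exclude \<open>n dvd m\<close> in the second case,
  where an inner edge would lie on an infinite path \<open>x, x + \<delta>, x + m, x + m + \<delta>, \<dots>\<close>.\<close>

lemma ordered_product_pow_12:
  assumes "n \<le> m" "0 \<le> a" "a < b" "b < n" "0 \<le> c" "c < d" "d < m"
  shows "(class_transposition a n b n \<circ> class_transposition c m d m) ^^ 12 = id"
proof -
  define s where "s = class_transposition a n b n"
  define t where "t = class_transposition c m d m"
  define \<delta> where "\<delta> = b - a"
  define \<epsilon> where "\<epsilon> = d - c"
  have bounds: "0 < \<delta>" "\<delta> < n" "0 < \<epsilon>" "\<epsilon> < m"
    using assms by (auto simp: \<delta>_def \<epsilon>_def)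
  have s_eq: "s x = (if n dvd x - a then x + \<delta> else if n dvd x - b then x - \<delta> else x)" for x
    by (simp add: s_def \<delta>_def horizontal_class_transposition_eq)
  have t_eq: "t x = (if m dvd x - c then x + \<epsilon> else if m dvd x - d then x - \<epsilon> else x)" for x
    by (simp add: t_def \<epsilon>_def horizontal_class_transposition_eq)
  have s: "s (s x) = x" and t: "t (t x) = x" for x
    using assms unfolding s_def t_def by (auto intro!: horizontal_class_transposition_involution)
  have zero: "z = 0" if "m dvd z" "\<bar>z\<bar> < m" for z
    using that not_dvd_of_abs_less by blast
  \<comment> \<open>Interchanging the ends of an inner edge reduces to an edge from \<open>a(n)\<close> to \<open>b(n)\<close>.\<close>
  have inner_lower: "((s \<circ> t) ^^ 12) x = x"
    if xa: "n dvd x - a" and tx: "t x \<noteq> x" and tsx: "t (s x) \<noteq> s x" for x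
  proof -
    have sx: "s x = x + \<delta>" using xa by (simp add: s_eq)
    have cd: "m dvd x - c \<or> m dvd x - d"
      using tx by (auto simp: t_eq split: if_splits)
    have cd': "m dvd x + \<delta> - c \<or> m dvd x + \<delta> - d"
      using tsx by (auto simp: t_eq sx split: if_splits)
    have same: False if "m dvd x - r" "m dvd x + \<delta> - r" for r
      using zero[of \<delta>] dvd_diff[OF that(2,1)] bounds assms(1) by simp
    consider "m dvd x - c" "m dvd x + \<delta> - d" | "m dvd x - d" "m dvd x + \<delta> - c"
      using cd cd' same by blast
    then show ?thesis
    proof cases
      case 1
      have "m dvd \<delta> - \<epsilon>"
        using dvd_diff[OF 1(2,1)] by (simp add: \<epsilon>_def algebra_simps)
      then have "\<delta> = \<epsilon>"
        using zero[of "\<delta> - \<epsilon>"] bounds assms(1) by simp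
      then have "t x = s x" using 1 sx by (simp add: t_eq)
      then show ?thesis by (intro fixed_point_pow_12[of 1]) (simp_all add: s)
    next
      case 2
      have "m dvd (x + \<delta> - c) - (x - d) - m"
        using dvd_diff[OF dvd_diff[OF 2(2,1)] dvd_refl] .
      then have "m dvd \<delta> + \<epsilon> - m"
        by (simp add: \<epsilon>_def algebra_simps)
      then have sum: "\<delta> + \<epsilon> = m"
        using zero[of "\<delta> + \<epsilon> - m"] bounds assms(1) by simp
      \<comment> \<open>If \<open>n\<close> divided \<open>m\<close>, then \<open>x + \<delta>\<close> would make \<open>b\<close> and \<open>c\<close> congruent modulo \<open>n\<close>, but
        \<open>d < m\<close> gives \<open>c < m - \<epsilon> = \<delta> \<le> b < n\<close>.\<close>
      have not_nm: "\<not> n dvd m"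
      proof
        assume nm: "n dvd m"
        have "n dvd (x - a) - (x + \<delta> - c)"
          using xa dvd_trans[OF nm 2(2)] by (rule dvd_diff)
        then have "n dvd c - b" by (simp add: \<delta>_def algebra_simps)
        moreover have "c < b"
          using assms sum by (simp add: \<delta>_def \<epsilon>_def)
        ultimately show False
          using not_dvd_of_abs_less[of "c - b" n] assms by auto
      qed
      have tx_eq: "t x = x - \<epsilon>"
        using 2(1) not_dvd_of_abs_less[of "d - c" m] dvd_diff[of m "x - c" "x - d"] assms
        by (auto simp: t_eq)
      have tsx_eq: "t (x + \<delta>) = x + m"
        using 2(2) sum by (simp add: t_eq algebra_simps)
      \<comment> \<open>The path continues beyond \<open>t x\<close> or \<open>t (s x)\<close> only if these points lie in \<open>a(n)\<close> or \<open>b(n)\<close>.\<close>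
      have iff1: "n dvd x - \<epsilon> - a \<longleftrightarrow> n dvd \<epsilon>"
        using dvd_diff_right_iff[OF xa, of \<epsilon>] by (simp add: algebra_simps)
      have nb1: "\<not> n dvd x - \<epsilon> - b"
      proof
        assume "n dvd x - \<epsilon> - b"
        then have "n dvd (x - a) - (x - \<epsilon> - b)" by (rule dvd_diff[OF xa])
        moreover have "(x - a) - (x - \<epsilon> - b) = m" using sum by (simp add: \<delta>_def)
        ultimately show False using not_nm by simp
      qed
      have na2: "\<not> n dvd x + m - a"
      proof
        assume "n dvd x + m - a"
        then have "n dvd (x + m - a) - (x - a)" using xa by (rule dvd_diff)
        then show False using not_nm by simp
      qed
      have "x + m - b = (x - a) + \<epsilon>" using sum by (simp add: \<delta>_def)
      then have iff2: "n dvd x + m - b \<longleftrightarrow> n dvd \<epsilon>"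
        by (simp only: dvd_add_right_iff[OF xa])
      show ?thesis
      proof (cases "n dvd \<epsilon>")
        case False
        \<comment> \<open>The path is \<open>t x, x, s x, t (s x)\<close>.\<close>
        have "s (t x) = t x" "s (t (s x)) = t (s x)"
          using False iff1 nb1 iff2 na2 by (simp_all add: s_eq[of "x - \<epsilon>"] s_eq[of "x + m"] tx_eq tsx_eq sx)
        then show ?thesis
          by (intro fixed_point_pow_12[of 4]) (simp add: s t numeral_eq_Suc, simp)
      next
        case True
        \<comment> \<open>The path is \<open>s (t x), t x, x, s x, t (s x), s (t (s x))\<close>. It stops there because its ends
          differ from \<open>c\<close> and \<open>d\<close> modulo \<open>m\<close> by \<open>\<epsilon>\<close> or \<open>2 * \<epsilon>\<close> up to sign; \<open>2 * \<epsilon> = m\<close> would give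
          \<open>\<delta> = \<epsilon> \<ge> n\<close>.\<close>
        have "n \<le> \<epsilon>" using True bounds by (simp add: zdvd_imp_le)
        then have "2 * \<epsilon> \<noteq> m" using sum bounds by simp
        moreover have "\<bar>2 * \<epsilon> - m\<bar> < m" using bounds by linarith
        ultimately have not_2: "\<not> m dvd 2 * \<epsilon>"
          using zero[of "2 * \<epsilon> - m"] by auto
        have not_1: "\<not> m dvd \<epsilon>" using not_dvd_of_abs_less[of \<epsilon> m] bounds by auto
        have stx: "s (t x) = x - \<epsilon> + \<delta>" using True iff1 by (simp add: tx_eq s_eq[of "x - \<epsilon>"])
        have stsx: "s (t (s x)) = x + \<epsilon>"
          using True iff2 na2 sum by (simp add: sx tsx_eq s_eq[of "x + m"])
        have "\<not> m dvd x - \<epsilon> + \<delta> - c"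
          using not_1 dvd_diff[OF 2(2), of "x - \<epsilon> + \<delta> - c"] by auto
        moreover have "\<not> m dvd x - \<epsilon> + \<delta> - d"
          using not_2 dvd_diff[OF 2(2), of "x - \<epsilon> + \<delta> - d"] by (auto simp: \<epsilon>_def algebra_simps)
        ultimately have 3: "t (s (t x)) = s (t x)" by (simp add: stx t_eq[of "x - \<epsilon> + \<delta>"])
        have "\<not> m dvd x + \<epsilon> - d"
          using not_1 dvd_diff[OF _ 2(1), of "x + \<epsilon> - d"] by auto
        moreover have "\<not> m dvd x + \<epsilon> - c"
          using not_2 dvd_diff[OF _ 2(1), of "x + \<epsilon> - c"] by (auto simp: \<epsilon>_def algebra_simps)
        ultimately have 4: "t (s (t (s x))) = s (t (s x))" by (simp add: stsx t_eq[of "x + \<epsilon>"])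
        show ?thesis
          using 3 4 by (intro fixed_point_pow_12[of 6]) (simp add: s t numeral_eq_Suc, simp)
      qed
    qed
  qed
  have "((s \<circ> t) ^^ 12) x = x" if "s x \<noteq> x" "t x \<noteq> x" "t (s x) \<noteq> s x" for x
  proof (cases "n dvd x - a")
    case True
    then show ?thesis using inner_lower that by blast
  next
    case False
    then have "n dvd x - b" "s x = x - \<delta>" using that(1) by (auto simp: s_eq split: if_splits)
    then have "n dvd s x - a" by (simp add: \<delta>_def)
    then have "((s \<circ> t) ^^ 12) (s x) = s x" using inner_lower[of "s x"] that s by simp
    then show ?thesis using funpow_involutions_left[OF s t, of 12 "s x"] by (simp add: s)
  qed
  then have "(s \<circ> t) ^^ 12 = id" by (intro involutions_pow_12 s t)
  then show ?thesis by (simp add: s_def t_def)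
qed

lemma horizontal_class_transpositionsE:
  assumes "\<sigma> \<in> horizontal_class_transpositions"
  obtains a b n where "0 \<le> a" "a < b" "b < n" "\<sigma> = class_transposition a n b n"
proof -
  obtain a b n where *: "0 \<le> a" "a < n" "0 \<le> b" "b < n" "a \<noteq> b"
    "\<sigma> = class_transposition a n b n"
    using assms by (auto simp: horizontal_class_transpositions_def)
  show thesis
  proof (cases "a < b")
    case True
    then show thesis using * that by blast
  next
    case False
    then show thesis
      using * that[of b a n] horizontal_class_transposition_commute[of a n b] by simp
  qed
qed

lemma horizontal_product_pow_12:
  assumes "\<sigma> \<in> horizontal_class_transpositions" "\<tau> \<in> horizontal_class_transpositions"
  shows "(\<sigma> \<circ> \<tau>) ^^ 12 = id"
proof -
  obtain a b n where 1: "0 \<le> a" "a < b" "b < n" "\<sigma> = class_transposition a n b n"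
    using assms(1) by (rule horizontal_class_transpositionsE)
  obtain c d m where 2: "0 \<le> c" "c < d" "d < m" "\<tau> = class_transposition c m d m"
    using assms(2) by (rule horizontal_class_transpositionsE)
  show ?thesis
  proof (cases "n \<le> m")
    case True
    then show ?thesis using ordered_product_pow_12[of n m a b c d] 1 2 by simp
  next
    case False
    have "\<sigma> (\<sigma> x) = x" "\<tau> (\<tau> x) = x" for x
      using 1 2 by (simp_all add: horizontal_class_transposition_involution)
    moreover have "(\<tau> \<circ> \<sigma>) ^^ 12 = id"
      using False ordered_product_pow_12[of m n c d a b] 1 2 by simp
    ultimately show ?thesis
      using funpow_involutions_swap[of \<tau> \<sigma> 12] by (simp add: fun_eq_iff)
  qed
qed

section \<open>Orders in the symmetric group of the integers\<close>

lemma Sym_int_mult: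
  assumes "f \<in> carrier Sym_int" "g \<in> carrier Sym_int"
  shows "f \<otimes>\<^bsub>Sym_int\<^esub> g = f \<circ> g"
  using assms by (simp add: BijGroup_def fun_eq_iff compose_def)

lemma Sym_int_pow:
  assumes "f \<in> carrier Sym_int"
  shows "f [^]\<^bsub>Sym_int\<^esub> (k::nat) = f ^^ k"
proof -
  interpret group Sym_int by (rule group_BijGroup)
  show ?thesis
  proof (induction k)
    case 0
    show ?case by (simp add: BijGroup_def fun_eq_iff)
  next
    case (Suc k)
    then show ?case
      using Sym_int_mult[OF nat_pow_closed[OF assms] assms, of k] by (simp only: nat_pow_Suc funpow_Suc_right)
  qed
qed

lemma Sym_int_ord_dvd_iff:
  assumes "f \<in> carrier Sym_int"
  shows "group.ord Sym_int f dvd k \<longleftrightarrow> f ^^ k = id"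
proof -
  interpret group Sym_int by (rule group_BijGroup)
  have "\<one>\<^bsub>Sym_int\<^esub> = id" by (simp add: BijGroup_def fun_eq_iff)
  then show ?thesis
    using pow_eq_id[OF assms, of k] Sym_int_pow[OF assms] by simp
qed

lemma divisors_12: "k dvd 12 \<Longrightarrow> k \<in> {1, 2, 3, 4, 6, 12}" for k :: nat
proof -
  assume k: "k dvd 12"
  then have "k \<in> {..12}" by (simp add: dvd_imp_le)
  also have "{..12} = {0,1,2,3,4,5,6,7,8,9,10,11,12::nat}" by (simp add: eval_nat_numeral atMost_Suc) blast
  finally show ?thesis using k by (elim insertE emptyE) simp_all
qed

lemma horizontal_product_in_Sym_int:
  assumes "\<sigma> \<in> horizontal_class_transpositions" "\<tau> \<in> horizontal_class_transpositions"
  shows "\<sigma> \<otimes>\<^bsub>Sym_int\<^esub> \<tau> = \<sigma> \<circ> \<tau>" "\<sigma> \<circ> \<tau> \<in> carrier Sym_int"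
proof -
  interpret group Sym_int by (rule group_BijGroup)
  have "\<sigma> \<in> carrier Sym_int" "\<tau> \<in> carrier Sym_int"
    using assms horizontal_class_transpositions_in_Sym_int by blast+
  then show "\<sigma> \<otimes>\<^bsub>Sym_int\<^esub> \<tau> = \<sigma> \<circ> \<tau>" "\<sigma> \<circ> \<tau> \<in> carrier Sym_int"
    using Sym_int_mult m_closed by metis+
qed

lemma funpow_periodic_eq_id:
  fixes f :: "int \<Rightarrow> int"
  assumes L: "0 < L" and shift: "\<And>x. f (x + L) = f x + L"
    and window: "\<And>x. 0 \<le> x \<Longrightarrow> x < L \<Longrightarrow> (f ^^ k) x = x"
  shows "f ^^ k = id"
proof
  fix x
  have f_add: "(f ^^ k) (y + L) = (f ^^ k) y + L" for y
    by (induction k) (simp_all add: shift)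
  have "(f ^^ k) (y + q * L) = (f ^^ k) y + q * L" for y q
  proof (induction q rule: int_induct[where k = 0])
    case (step1 q)
    then show ?case using f_add[of "y + q * L"] by (simp add: algebra_simps)
  next
    case (step2 q)
    then show ?case using f_add[of "y + (q - 1) * L"] by (simp add: algebra_simps)
  qed simp
  from this[of "x mod L" "x div L"] window[of "x mod L"] L
  show "(f ^^ k) x = id x" by simp
qed

lemma horizontal_class_transposition_shift:
  assumes "n dvd L"
  shows "class_transposition a n b n (x + L) = class_transposition a n b n x + L"
proof -
  have "n dvd x + L - r \<longleftrightarrow> n dvd x - r" for r
    using dvd_add_left_iff[OF assms, of "x - r"] by (simp add: algebra_simps)
  then show ?thesis by (simp add: horizontal_class_transposition_eq)
qed

text \<open>The two conditions on the powers of \<open>f\<close> concern finitely many points, so that they can be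
  evaluated. A proper divisor of \<open>k\<close> is a divisor of \<open>12\<close> other than \<open>12\<close>, hence one of the listed \<open>j\<close>.\<close>

lemma horizontal_product_order_witness:
  fixes a b n c d m L :: int and k :: nat
  defines "f \<equiv> class_transposition a n b n \<circ> class_transposition c m d m"
  assumes "0 \<le> a" "a < b" "b < n" "0 \<le> c" "c < d" "d < m"
    and period: "0 < L" "n dvd L" "m dvd L"
    and pow: "\<forall>x \<in> {0..L - 1}. (f ^^ k) x = x"
    and min: "k dvd 12" "\<forall>j \<in> {1, 2, 3, 4, 6}. j dvd k \<longrightarrow> j \<noteq> k \<longrightarrow> (\<exists>x. (f ^^ j) x \<noteq> x)"
  shows "\<exists>\<sigma> \<in> horizontal_class_transpositions. \<exists>\<tau> \<in> horizontal_class_transpositions.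
    group.ord Sym_int (\<sigma> \<otimes>\<^bsub>Sym_int\<^esub> \<tau>) = k"
proof -
  let ?\<sigma> = "class_transposition a n b n" and ?\<tau> = "class_transposition c m d m"
  let ?o = "group.ord Sym_int f"
  have mem: "?\<sigma> \<in> horizontal_class_transpositions" "?\<tau> \<in> horizontal_class_transpositions"
    unfolding horizontal_class_transpositions_def using assms(2-7) by force+
  have prod: "?\<sigma> \<otimes>\<^bsub>Sym_int\<^esub> ?\<tau> = f" "f \<in> carrier Sym_int"
    using horizontal_product_in_Sym_int[OF mem] by (simp_all add: f_def)
  have "f (x + L) = f x + L" for x
    using period by (simp add: f_def horizontal_class_transposition_shift)
  then have "f ^^ k = id"
    using pow period by (intro funpow_periodic_eq_id[of L]) auto
  then have ord_dvd: "?o dvd k"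
    using Sym_int_ord_dvd_iff[OF prod(2)] by simp
  have fixed: "(f ^^ ?o) x = x" for x
    using Sym_int_ord_dvd_iff[OF prod(2), of ?o] by simp
  have "?o = k"
  proof (rule ccontr)
    assume ne: "?o \<noteq> k"
    then have "?o \<noteq> 12"
      using ord_dvd min(1) dvd_antisym by metis
    then have "?o \<in> {1, 2, 3, 4, 6}"
      using divisors_12[OF dvd_trans[OF ord_dvd min(1)]] by blast
    from min(2)[rule_format, OF this ord_dvd ne] show False
      using fixed by simp
  qed
  then show ?thesis using mem prod(1) by metis
qed

theorem corollary5p5:
  shows "(\<forall>\<sigma> \<in> horizontal_class_transpositions. \<forall>\<tau> \<in> horizontal_class_transpositions.
            group.ord Sym_int (\<sigma> \<otimes>\<^bsub>Sym_int\<^esub> \<tau>) \<in> {1, 2, 3, 4, 6, 12})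
       \<and> (\<forall>d \<in> {1, 2, 3, 4, 6, 12 :: nat}.
            \<exists>\<sigma> \<in> horizontal_class_transpositions. \<exists>\<tau> \<in> horizontal_class_transpositions.
              group.ord Sym_int (\<sigma> \<otimes>\<^bsub>Sym_int\<^esub> \<tau>) = d)"
    (is "?orders \<and> (\<forall>d \<in> _. ?attained d)")
proof
  show ?orders
  proof (intro ballI divisors_12)
    fix \<sigma> \<tau>
    assume mem: "\<sigma> \<in> horizontal_class_transpositions" "\<tau> \<in> horizontal_class_transpositions"
    show "group.ord Sym_int (\<sigma> \<otimes>\<^bsub>Sym_int\<^esub> \<tau>) dvd 12"
      using Sym_int_ord_dvd_iff horizontal_product_in_Sym_int[OF mem]
        horizontal_product_pow_12[OF mem] by simp
  qed
next
  \<comment> \<open>Applying the function to the numeral before the remaining iterations keeps every argument a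
    numeral, so the case distinctions in the transpositions are decided at once.\<close>
  have funpow_step: "(g ^^ numeral k) x = (g ^^ pred_numeral k) (g x)" for g :: "int \<Rightarrow> int" and k x
    by (simp add: numeral_eq_Suc funpow_swap1)
  note evaluate = horizontal_class_transposition_eq funpow_step
  have "?attained 1"
  proof (rule horizontal_product_order_witness[of 0 1 2 0 1 2 2])
    let ?f = "class_transposition 0 2 1 2 \<circ> class_transposition 0 2 1 2"
    show "\<forall>x \<in> {0..2 - 1}. (?f ^^ 1) x = x"
      by (simp add: horizontal_class_transposition_involution)
    show "\<forall>j \<in> {1, 2, 3, 4, 6}. j dvd 1 \<longrightarrow> j \<noteq> 1 \<longrightarrow> (\<exists>x. (?f ^^ j) x \<noteq> x)"
      by auto
  qed simp_all
  moreover have "?attained 2"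
  proof (rule horizontal_product_order_witness[of 0 1 4 2 3 4 4])
    let ?f = "class_transposition 0 4 1 4 \<circ> class_transposition 2 4 3 4"
    show "\<forall>x \<in> {0..4 - 1}. (?f ^^ 2) x = x"
      by (simp add: simp_from_to) (simp add: evaluate)
    have "(?f ^^ 1) 0 \<noteq> 0"
      by (simp add: evaluate)
    then show "\<forall>j \<in> {1, 2, 3, 4, 6}. j dvd 2 \<longrightarrow> j \<noteq> 2 \<longrightarrow> (\<exists>x. (?f ^^ j) x \<noteq> x)"
      by auto
  qed simp_all
  moreover have "?attained 3"
  proof (rule horizontal_product_order_witness[of 0 1 3 0 2 3 3])
    let ?f = "class_transposition 0 3 1 3 \<circ> class_transposition 0 3 2 3"
    show "\<forall>x \<in> {0..3 - 1}. (?f ^^ 3) x = x"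
      by (simp add: simp_from_to) (simp add: evaluate)
    have "(?f ^^ 1) 0 \<noteq> 0"
      by (simp add: evaluate)
    then show "\<forall>j \<in> {1, 2, 3, 4, 6}. j dvd 3 \<longrightarrow> j \<noteq> 3 \<longrightarrow> (\<exists>x. (?f ^^ j) x \<noteq> x)"
      by auto
  qed simp_all
  \<comment> \<open>Here every component is a path with four vertices, in the next example with six.\<close>
  moreover have "?attained 4"
  proof (rule horizontal_product_order_witness[of 0 1 2 0 2 4 4])
    let ?f = "class_transposition 0 2 1 2 \<circ> class_transposition 0 4 2 4"
    show "\<forall>x \<in> {0..4 - 1}. (?f ^^ 4) x = x"
      by (simp add: simp_from_to) (simp add: evaluate)
    have "(?f ^^ 1) 0 \<noteq> 0" "(?f ^^ 2) 0 \<noteq> 0"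
      by (simp_all add: evaluate)
    then show "\<forall>j \<in> {1, 2, 3, 4, 6}. j dvd 4 \<longrightarrow> j \<noteq> 4 \<longrightarrow> (\<exists>x. (?f ^^ j) x \<noteq> x)"
      by auto
  qed simp_all
  moreover have "?attained 6"
  proof (rule horizontal_product_order_witness[of 0 1 2 0 2 3 6])
    let ?f = "class_transposition 0 2 1 2 \<circ> class_transposition 0 3 2 3"
    show "\<forall>x \<in> {0..6 - 1}. (?f ^^ 6) x = x"
      by (simp add: simp_from_to) (simp add: evaluate)
    have "(?f ^^ 1) 0 \<noteq> 0" "(?f ^^ 2) 0 \<noteq> 0" "(?f ^^ 3) 0 \<noteq> 0"
      by (simp_all add: evaluate)
    then show "\<forall>j \<in> {1, 2, 3, 4, 6}. j dvd 6 \<longrightarrow> j \<noteq> 6 \<longrightarrow> (\<exists>x. (?f ^^ j) x \<noteq> x)"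
      by auto
  qed simp_all
  moreover have "?attained 12"
  proof (rule horizontal_product_order_witness[of 0 1 3 0 2 4 12])
    let ?f = "class_transposition 0 3 1 3 \<circ> class_transposition 0 4 2 4"
    show "\<forall>x \<in> {0..12 - 1}. (?f ^^ 12) x = x"
      by (simp add: simp_from_to) (simp add: evaluate)
    \<comment> \<open>The component of \<open>0\<close> has three vertices and that of \<open>3\<close> has four.\<close>
    have "(?f ^^ 1) 0 \<noteq> 0" "(?f ^^ 2) 0 \<noteq> 0" "(?f ^^ 4) 0 \<noteq> 0" "(?f ^^ 3) 3 \<noteq> 3" "(?f ^^ 6) 3 \<noteq> 3"
      by (simp_all add: evaluate)
    then show "\<forall>j \<in> {1, 2, 3, 4, 6}. j dvd 12 \<longrightarrow> j \<noteq> 12 \<longrightarrow> (\<exists>x. (?f ^^ j) x \<noteq> x)"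
      by auto
  qed simp_all
  ultimately show "\<forall>d \<in> {1, 2, 3, 4, 6, 12}. ?attained d" by blast
qed

end
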